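(* Let $A\in C(\mathbb{R},\mathrm{SL}(3,\mathbb{R}))\cap C^2(\mathbb{R},\mathbb{M}^3)$ be a solution of $$A''(t)=\frac{\operatorname{tr}\bigl[(A'(t)A(t)^{-1})^2\bigr]}{\operatorname{tr}(A(t)^{-\top}A(t)^{-1})}\,A(t)^{-\top}$$ with $E_K(0)=\frac12\operatorname{tr}A'(0)A'(0)^\top>0$. Let $T\in\mathbb{R}$ and suppose that $\kappa(t)\ge0$ for all $t\ge T$, where $$\kappa(t)=\frac{\operatorname{tr}\bigl[(A'(t)A(t)^{-1})^2\bigr]}{2E_K(0)\,(\operatorname{tr}A(t)^{-\top}A(t)^{-1})^{1/2}}.$$ Let $\Omega_t=A(t)B$ with $B=\{y\in\mathbb{R}^3:|y|<1\}$. Then $$\operatorname{diam}\Omega_t\sim(\operatorname{tr}A(t)A(t)^\top)^{1/2}\sim1+|t|,\quad t\ge T.$$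
   Context: $\mathbb{M}^3$ is the space of real $3\times3$ matrices, $\mathrm{SL}(3,\mathbb{R})=\{A\in\mathbb{M}^3:\det A=1\}$, $A^{-\top}=(A^{-1})^\top$. For nonnegative functions, $x\lesssim y$ means $x\le c\,y$ on the indicated range of $t$ for some constant $c>0$ (which may depend on the solution $A$ and on $T$, but not on $t$); $x\sim y$ means $x\lesssim y$ and $y\lesssim x$. *)

theory Defs
  imports "HOL-Analysis.Analysis"
begin

definition SL3 :: "(real^3^3) set"
  where "SL3 = {M. det M = 1}"

text \<open>The time derivative of a matrix-valued curve. It is the genuine derivative only where the
  curve is differentiable; below it is applied to curves known to be twice continuously
  differentiable.\<close>

definition tderiv :: "(real \<Rightarrow> real^3^3) \<Rightarrow> real \<Rightarrow> real^3^3"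
  where "tderiv A t = vector_derivative A (at t)"

definition C2_curve :: "(real \<Rightarrow> real^3^3) \<Rightarrow> bool"
  where "C2_curve A \<longleftrightarrow>
    A C1_differentiable_on UNIV \<and> tderiv A C1_differentiable_on UNIV"

definition inv_transpose :: "real^3^3 \<Rightarrow> real^3^3"
  where "inv_transpose M = transpose (matrix_inv M)"

definition trace_vgrad_sq :: "(real \<Rightarrow> real^3^3) \<Rightarrow> real \<Rightarrow> real"
  where "trace_vgrad_sq A t =
    trace ((tderiv A t ** matrix_inv (A t)) ** (tderiv A t ** matrix_inv (A t)))"

definition affine_motion :: "(real \<Rightarrow> real^3^3) \<Rightarrow> bool"
  where "affine_motion A \<longleftrightarrow>
    continuous_on UNIV A \<and> (\<forall>t. A t \<in> SL3) \<and> C2_curve A \<and>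
    (\<forall>t. tderiv (tderiv A) t =
       (trace_vgrad_sq A t / trace (inv_transpose (A t) ** matrix_inv (A t))) *\<^sub>R inv_transpose (A t))"

definition kinetic_energy :: "(real \<Rightarrow> real^3^3) \<Rightarrow> real \<Rightarrow> real"
  where "kinetic_energy A t = 1 / 2 * trace (tderiv A t ** transpose (tderiv A t))"

definition kappa :: "(real \<Rightarrow> real^3^3) \<Rightarrow> real \<Rightarrow> real"
  where "kappa A t =
    trace_vgrad_sq A t /
      (2 * kinetic_energy A 0 * sqrt (trace (inv_transpose (A t) ** matrix_inv (A t))))"

definition fluid_domain :: "(real \<Rightarrow> real^3^3) \<Rightarrow> real \<Rightarrow> (real^3) set"
  where "fluid_domain A t = (\<lambda>y. A t *v y) ` ball 0 1"

text \<open>Comparison of nonnegative functions with a constant that is uniform over the whole range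
  \<open>S\<close> (not merely eventually).\<close>

definition lesssim_on :: "real set \<Rightarrow> (real \<Rightarrow> real) \<Rightarrow> (real \<Rightarrow> real) \<Rightarrow> bool"
  where "lesssim_on S f g \<longleftrightarrow> (\<exists>c>0. \<forall>t\<in>S. f t \<le> c * g t)"

definition sim_on :: "real set \<Rightarrow> (real \<Rightarrow> real) \<Rightarrow> (real \<Rightarrow> real) \<Rightarrow> bool"
  where "sim_on S f g \<longleftrightarrow> lesssim_on S f g \<and> lesssim_on S g f"

end

theory Submission
  imports Defs
begin

text \<open>
  Give the \<open>3 \<times> 3\<close> matrices the Frobenius inner product \<open>M \<bullet> N = tr (M N\<^sup>T)\<close>, which is the
  Euclidean structure of \<^typ>\<open>real^3^3\<close>. The equation of motion says that \<open>A\<close> is a geodesic of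
  the submanifold \<open>det = 1\<close>: the acceleration is a multiple \<open>\<lambda>\<close> of the normal vector
  \<open>N = A\<^sup>-\<^sup>T\<close>. Two inner products with \<open>N\<close> are all that the proof uses.

  \<^item> \<open>A' \<bullet> N = tr (A' A\<^sup>-\<^sup>1) = 0\<close>, because the curve stays on \<open>det = 1\<close>
    (\<open>trace_derivative_mult_inverse_eq_0\<close>). Hence the speed \<open>v = |A'|\<close> is constant, which bounds
    \<open>|A(t)|\<close> above by a linear function of \<open>t\<close> (\<open>norm_le_linear\<close>).
  \<^item> \<open>A \<bullet> N = tr 1 = 3\<close>. Hence \<open>(A \<bullet> A')' = v\<^sup>2 + 3 \<lambda>\<close>. The sign condition on \<open>\<kappa>\<close> means
    \<open>\<lambda> \<ge> 0\<close>, so \<open>A \<bullet> A'\<close> grows at least like \<open>v\<^sup>2 t\<close>. Since \<open>A \<bullet> A' \<le> v |A|\<close>, the norm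
    \<open>|A(t)|\<close> grows at least like \<open>v t\<close> (\<open>norm_ge_linear\<close>).

  The linear lower bound may be negative for \<open>t\<close> near \<open>T\<close>; there \<open>det A = 1\<close> keeps \<open>|A|\<close>
  away from zero (\<open>norm_ge_half_if_det_1\<close>). Finally, the diameter of the image of a ball is
  comparable with the Frobenius norm for every linear map.
\<close>

section \<open>The Frobenius norm and the diameter of an ellipsoid\<close>

lemma trace_mult_transpose_eq_inner:
  fixes M N :: "real^'n^'m"
  shows "trace (M ** transpose N) = M \<bullet> N"
  by (simp add: trace_def matrix_matrix_mult_def transpose_def inner_vec_def)

lemma sqrt_trace_mult_transpose_eq_norm:
  fixes M :: "real^'n^'m"
  shows "sqrt (trace (M ** transpose M)) = norm M"
  by (simp add: trace_mult_transpose_eq_inner norm_eq_sqrt_inner)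

lemma norm_matrix_vector_mult_le:
  fixes M :: "real^'n^'m"
  shows "norm (M *v y) \<le> norm M * norm y"
proof -
  have "norm (M *v y) = L2_set (\<lambda>i. \<bar>M $ i \<bullet> y\<bar>) UNIV"
    by (simp add: norm_vec_def matrix_vector_mul_component)
  also have "\<dots> \<le> L2_set (\<lambda>i. norm (M $ i) * norm y) UNIV"
    by (intro L2_set_mono Cauchy_Schwarz_ineq2) auto
  also have "\<dots> = norm M * norm y"
    by (simp add: norm_vec_def[of M] L2_set_left_distrib)
  finally show ?thesis .
qed

lemma norm_matrix_squared_eq_sum_columns:
  fixes M :: "real^'n^'m"
  shows "(norm M)\<^sup>2 = (\<Sum>j\<in>UNIV. (norm (M *v axis j 1))\<^sup>2)"
proof -
  have "(norm M)\<^sup>2 = (\<Sum>i\<in>UNIV. \<Sum>j\<in>UNIV. (M $ i $ j)\<^sup>2)"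
    unfolding power2_norm_eq_inner by (simp add: inner_vec_def power2_eq_square)
  also have "\<dots> = (\<Sum>j\<in>UNIV. \<Sum>i\<in>UNIV. (M $ i $ j)\<^sup>2)"
    by (rule sum.swap)
  also have "\<dots> = (\<Sum>j\<in>UNIV. (norm (M *v axis j 1))\<^sup>2)"
    unfolding power2_norm_eq_inner
    by (simp add: inner_vec_def power2_eq_square matrix_vector_mult_basis column_def)
  finally show ?thesis .
qed

lemma diameter_linear_image_ball_le:
  fixes M :: "real^'n^'m"
  shows "diameter ((\<lambda>y. M *v y) ` ball 0 1) \<le> 2 * norm M"
proof (rule diameter_le)
  fix p q assume "p \<in> (\<lambda>y. M *v y) ` ball 0 1" "q \<in> (\<lambda>y. M *v y) ` ball 0 1"
  then obtain y z where p: "p = M *v y" "norm y < 1" and q: "q = M *v z" "norm z < 1"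
    by auto
  have "norm (p - q) = norm (M *v (y - z))"
    by (simp add: p q matrix_vector_mult_diff_distrib)
  also have "\<dots> \<le> norm M * norm (y - z)"
    by (rule norm_matrix_vector_mult_le)
  also have "\<dots> \<le> norm M * 2"
    using norm_triangle_ineq4[of y z] p q by (intro mult_left_mono) auto
  finally show "norm (p - q) \<le> 2 * norm M" by simp
qed auto

text \<open>The segment from \<open>-e\<^sub>j / 2\<close> to \<open>e\<^sub>j / 2\<close> lies in the open unit ball, so every column
  \<open>M e\<^sub>j\<close> is at most as long as the diameter, and the Frobenius norm is the Euclidean sum of the
  column lengths.\<close>

lemma norm_le_diameter_linear_image_ball:
  fixes M :: "real^'n^'m"
  shows "norm M \<le> sqrt (CARD('n)) * diameter ((\<lambda>y. M *v y) ` ball 0 1)"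
proof -
  let ?D = "diameter ((\<lambda>y. M *v y) ` ball 0 1)"
  have bnd: "bounded ((\<lambda>y. M *v y) ` ball 0 1)"
    by (simp add: bounded_linear_image)
  have col: "norm (M *v axis j 1) \<le> ?D" for j
  proof -
    let ?h = "(1/2) *\<^sub>R axis j 1 :: real^'n"
    have "dist (M *v ?h) (M *v (- ?h)) \<le> ?D"
      by (rule diameter_bounded_bound[OF bnd]) (auto intro!: imageI)
    moreover have "dist (M *v ?h) (M *v (- ?h)) = norm (M *v (?h - - ?h))"
      by (simp only: dist_norm matrix_vector_mult_diff_distrib)
    moreover have "?h - - ?h = axis j 1"
      by (simp flip: scaleR_add_left)
    ultimately show ?thesis by simp
  qed
  have D0: "0 \<le> ?D" using bnd by (rule diameter_ge_0)
  have "(norm M)\<^sup>2 \<le> (\<Sum>j\<in>(UNIV::'n set). ?D\<^sup>2)"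
    unfolding norm_matrix_squared_eq_sum_columns
    by (intro sum_mono power_mono col) auto
  also have "\<dots> = (sqrt (CARD('n)) * ?D)\<^sup>2"
    by (simp add: power_mult_distrib)
  finally show ?thesis
    by (rule power2_le_imp_le) (simp add: D0)
qed

text \<open>Each of the six terms of the determinant is at most the cube of the Frobenius norm. The
  optimal constant is \<open>\<surd>3\<close>, but any positive one serves as a uniform lower bound.\<close>

lemma norm_ge_half_if_det_1:
  fixes M :: "real^3^3"
  assumes "det M = 1"
  shows "1 / 2 \<le> norm M"
proof (rule ccontr)
  assume "\<not> 1 / 2 \<le> norm M"
  then have small: "\<bar>M $ i $ j\<bar> \<le> 1 / 2" for i j
    using component_le_norm_cart[of "M $ i" j] Finite_Cartesian_Product.norm_nth_le[of M i]
    by linarith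
  have prod: "\<bar>M $ i $ j * M $ k $ l * M $ m $ n\<bar> \<le> 1 / 8" for i j k l m n
    using mult_mono[OF mult_mono[OF small[of i j] small[of k l]] small[of m n]]
    by (simp add: abs_mult)
  have "det M \<le> 6 / 8"
    unfolding det_3
    using prod[of 1 1 2 2 3 3, THEN abs_le_D1] prod[of 1 2 2 3 3 1, THEN abs_le_D1]
      prod[of 1 3 2 1 3 2, THEN abs_le_D1] prod[of 1 1 2 3 3 2, THEN abs_le_D2]
      prod[of 1 2 2 1 3 3, THEN abs_le_D2] prod[of 1 3 2 2 3 1, THEN abs_le_D2]
    by linarith
  then show False using assms by simp
qed

section \<open>Curves of matrices of determinant one\<close>

lemma has_vector_derivative_entry:
  fixes X :: "real \<Rightarrow> real^'n^'m"
  assumes "(X has_vector_derivative V) (at t)"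
  shows "((\<lambda>s. X s $ i $ j) has_real_derivative V $ i $ j) (at t)"
  using bounded_linear.has_vector_derivative[OF bounded_linear_vec_nth,
      OF bounded_linear.has_vector_derivative[OF bounded_linear_vec_nth assms]]
  by (simp add: has_real_derivative_iff_has_vector_derivative)

lemma has_real_derivative_det_at_identity:
  fixes X :: "real \<Rightarrow> real^3^3"
  assumes X: "(X has_vector_derivative V) (at t)" and "X t = mat 1"
  shows "((\<lambda>s. det (X s)) has_real_derivative trace V) (at t)"
proof -
  note [derivative_intros] = has_vector_derivative_entry[OF X]
  show ?thesis
    unfolding det_3
    by (auto intro!: derivative_eq_intros simp: assms(2) mat_def trace_def sum_3)
qed

lemma matrix_mult_inverse_if_det_1:
  fixes M :: "real^'n^'n"
  assumes "det M = 1"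
  shows "M ** matrix_inv M = mat 1"
proof -
  have "invertible M" using assms by (simp add: invertible_det_nz)
  then show ?thesis
    unfolding invertible_def matrix_inv_def by (rule someI2_ex) simp
qed

text \<open>The tangency condition. Right multiplication by the constant matrix \<open>A(t)\<^sup>-\<^sup>1\<close> moves the
  curve so that it passes through the identity at time \<open>t\<close> without changing its determinant;
  there the derivative of the determinant is the trace, so no cofactors appear.\<close>

lemma trace_derivative_mult_inverse_eq_0:
  fixes A :: "real \<Rightarrow> real^3^3"
  assumes A: "(A has_vector_derivative V) (at t)" and det: "\<And>s. det (A s) = 1"
  shows "trace (V ** matrix_inv (A t)) = 0"
proof -
  let ?P = "matrix_inv (A t)"
  have inv: "A t ** ?P = mat 1"
    by (rule matrix_mult_inverse_if_det_1[OF det])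
  have "bounded_linear (\<lambda>M :: real^3^3. M ** ?P)"
    by (intro linear_conv_bounded_linear[THEN iffD1] linearI)
       (simp_all add: matrix_matrix_mult_def vec_eq_iff sum.distrib sum_distrib_left algebra_simps)
  from bounded_linear.has_vector_derivative[OF this A]
  have "((\<lambda>s. det (A s ** ?P)) has_real_derivative trace (V ** ?P)) (at t)"
    by (rule has_real_derivative_det_at_identity) (rule inv)
  moreover have "det (A s ** ?P) = 1" for s
    using det_mul[of "A t" ?P] inv det by (simp add: det_mul)
  ultimately have "((\<lambda>s. 1) has_real_derivative trace (V ** ?P)) (at t)"
    by simp
  from DERIV_unique[OF this DERIV_const] show ?thesis .
qed

section \<open>Growth of affine motions\<close>

text \<open>The Lagrange multiplier of the constraint \<open>det = 1\<close>, that is, the scalar factor in the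
  equation of motion.\<close>

definition constraint_multiplier :: "(real \<Rightarrow> real^3^3) \<Rightarrow> real \<Rightarrow> real"
  where "constraint_multiplier A t =
    trace_vgrad_sq A t / trace (inv_transpose (A t) ** matrix_inv (A t))"

context
  fixes A :: "real \<Rightarrow> real^3^3"
  assumes motion: "affine_motion A"
begin

lemma det_eq_1: "det (A t) = 1"
  using motion by (auto simp: affine_motion_def SL3_def)

lemma has_velocity: "(A has_vector_derivative tderiv A t) (at t)"
  using motion unfolding affine_motion_def C2_curve_def C1_differentiable_on_def tderiv_def
  by (metis UNIV_I vector_derivative_at)

lemma has_acceleration:
  "(tderiv A has_vector_derivative constraint_multiplier A t *\<^sub>R inv_transpose (A t)) (at t)"
proof -
  have "(tderiv A has_vector_derivative tderiv (tderiv A) t) (at t)"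
    using motion unfolding affine_motion_def C2_curve_def C1_differentiable_on_def
      tderiv_def[of "tderiv A"]
    by (metis UNIV_I vector_derivative_at)
  then show ?thesis
    using motion by (simp add: affine_motion_def constraint_multiplier_def)
qed

lemma velocity_inner_inv_transpose: "tderiv A t \<bullet> inv_transpose (A t) = 0"
  using trace_derivative_mult_inverse_eq_0[OF has_velocity det_eq_1, of t]
  by (simp add: inv_transpose_def flip: trace_mult_transpose_eq_inner)

lemma position_inner_inv_transpose: "A t \<bullet> inv_transpose (A t) = 3"
  using matrix_mult_inverse_if_det_1[OF det_eq_1, of t]
  by (simp add: inv_transpose_def trace_I flip: trace_mult_transpose_eq_inner)

text \<open>The acceleration is normal to \<open>det = 1\<close> and the velocity is tangent, so the kinetic
  energy is conserved.\<close>

lemma speed_constant: "norm (tderiv A t) = sqrt (2 * kinetic_energy A 0)"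
proof -
  have "((\<lambda>t. tderiv A t \<bullet> tderiv A t) has_real_derivative 0) (at t)" for t
    using bounded_bilinear.has_vector_derivative
      [OF bounded_bilinear_inner has_acceleration[of t] has_acceleration[of t]]
    by (simp add: velocity_inner_inv_transpose inner_commute[of "inv_transpose (A t)"]
        has_real_derivative_iff_has_vector_derivative)
  then have "tderiv A t \<bullet> tderiv A t = tderiv A 0 \<bullet> tderiv A 0"
    using DERIV_isconst_all by blast
  then show ?thesis
    by (simp add: kinetic_energy_def trace_mult_transpose_eq_inner norm_eq_sqrt_inner)
qed

lemma position_inner_velocity_derivative:
  "((\<lambda>t. A t \<bullet> tderiv A t) has_real_derivative
      2 * kinetic_energy A 0 + 3 * constraint_multiplier A t) (at t)"
proof -
  have "tderiv A t \<bullet> tderiv A t = 2 * kinetic_energy A 0"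
    using speed_constant[of t] by (simp add: norm_eq_sqrt_inner)
  then show ?thesis
    using bounded_bilinear.has_vector_derivative
      [OF bounded_bilinear_inner has_velocity[of t] has_acceleration[of t]]
    by (simp add: position_inner_inv_transpose algebra_simps
        has_real_derivative_iff_has_vector_derivative)
qed

text \<open>The multiplier and \<open>\<kappa>\<close> have the same numerator over nonnegative denominators.\<close>

lemma constraint_multiplier_nonneg:
  assumes "kinetic_energy A 0 > 0" "kappa A t \<ge> 0"
  shows "constraint_multiplier A t \<ge> 0"
proof -
  have "trace (inv_transpose (A t) ** matrix_inv (A t)) = inv_transpose (A t) \<bullet> inv_transpose (A t)"
    by (simp add: inv_transpose_def flip: trace_mult_transpose_eq_inner)
  then have d: "trace (inv_transpose (A t) ** matrix_inv (A t)) \<ge> 0"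
    by simp
  show ?thesis
  proof (cases "trace (inv_transpose (A t) ** matrix_inv (A t)) = 0")
    case True
    \<comment> \<open>Division by zero yields zero.\<close>
    then show ?thesis by (simp add: constraint_multiplier_def)
  next
    case False
    with d assms(1)
    have "2 * kinetic_energy A 0 * sqrt (trace (inv_transpose (A t) ** matrix_inv (A t))) > 0"
      by simp
    with assms(2) have "trace_vgrad_sq A t \<ge> 0"
      by (simp add: kappa_def zero_le_divide_iff)
    with d show ?thesis by (simp add: constraint_multiplier_def)
  qed
qed

lemma norm_le_linear:
  "norm (A t) \<le> norm (A T) + sqrt (2 * kinetic_energy A 0) * \<bar>t - T\<bar>"
proof -
  have "norm (A t - A T) \<le> sqrt (2 * kinetic_energy A 0) * norm (t - T)"
  proof (rule differentiable_bound[where S = UNIV])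
    show "(A has_derivative (\<lambda>h. h *\<^sub>R tderiv A s)) (at s)" for s
      using has_velocity[of s] by (simp add: has_vector_derivative_def)
    show "onorm (\<lambda>h. h *\<^sub>R tderiv A s) \<le> sqrt (2 * kinetic_energy A 0)" for s
      by (simp add: onorm_scaleR_left onorm_id speed_constant)
  qed auto
  then show ?thesis
    using norm_triangle_sub[of "A t" "A T"] by simp
qed

text \<open>A single integration of \<open>(A \<bullet> A')' \<ge> v\<^sup>2\<close> from \<open>T\<close> to \<open>t\<close> bounds \<open>A \<bullet> A'\<close> below, and
  Cauchy-Schwarz with \<open>|A'| = v\<close> turns this into a bound on \<open>|A|\<close>. The
  initial value \<open>A(T) \<bullet> A'(T)\<close> may be negative, which costs the term \<open>|A(T)|\<close>.\<close>

lemma norm_ge_linear: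
  assumes E: "kinetic_energy A 0 > 0" and kappa: "\<And>t. t \<ge> T \<Longrightarrow> kappa A t \<ge> 0"
    and t: "t \<ge> T"
  defines "v \<equiv> sqrt (2 * kinetic_energy A 0)"
  shows "v * (t - T) - norm (A T) \<le> norm (A t)"
proof -
  have v: "v > 0" "v\<^sup>2 = 2 * kinetic_energy A 0"
    using E by (simp_all add: v_def)
  have speed: "norm (tderiv A s) = v" for s
    using speed_constant by (simp add: v_def)
  let ?g = "\<lambda>s. A s \<bullet> tderiv A s - v\<^sup>2 * s"
  have "?g T \<le> ?g t"
  proof (rule DERIV_nonneg_imp_nondecreasing[OF t])
    fix s assume s: "T \<le> s"
    have "(?g has_real_derivative 3 * constraint_multiplier A s) (at s)"
      by (rule derivative_eq_intros position_inner_velocity_derivative refl)+ (simp add: v)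
    then show "\<exists>y. (?g has_real_derivative y) (at s) \<and> 0 \<le> y"
      using constraint_multiplier_nonneg[OF E kappa[OF s]]
      by (intro exI[of _ "3 * constraint_multiplier A s"]) simp
  qed
  moreover have "A t \<bullet> tderiv A t \<le> norm (A t) * v"
    using norm_cauchy_schwarz[of "A t" "tderiv A t"] by (simp add: speed)
  moreover have "- (norm (A T) * v) \<le> A T \<bullet> tderiv A T"
    using Cauchy_Schwarz_ineq2[of "A T" "tderiv A T"] by (simp add: speed)
  ultimately have "v * (v * (t - T) - norm (A T)) \<le> v * norm (A t)"
    by (simp add: algebra_simps power2_eq_square)
  then show ?thesis
    using v by simp
qed

end

theorem theorem4:
  fixes A :: "real \<Rightarrow> real^3^3" and T :: real
  assumes "affine_motion A"
    and "kinetic_energy A 0 > 0"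
    and "\<And>t. t \<ge> T \<Longrightarrow> kappa A t \<ge> 0"
  shows "sim_on {T..} (\<lambda>t. diameter (fluid_domain A t)) (\<lambda>t. sqrt (trace (A t ** transpose (A t)))) \<and>
         sim_on {T..} (\<lambda>t. sqrt (trace (A t ** transpose (A t)))) (\<lambda>t. 1 + \<bar>t\<bar>)"
proof -
  let ?v = "sqrt (2 * kinetic_energy A 0)" and ?a = "norm (A T)"
  have v: "?v > 0" using assms(2) by simp
  have "lesssim_on {T..} (\<lambda>t. diameter (fluid_domain A t)) (\<lambda>t. norm (A t))"
    unfolding lesssim_on_def fluid_domain_def
    by (intro exI[of _ 2]) (auto intro: diameter_linear_image_ball_le)
  moreover have "lesssim_on {T..} (\<lambda>t. norm (A t)) (\<lambda>t. diameter (fluid_domain A t))"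
    unfolding lesssim_on_def fluid_domain_def
    using norm_le_diameter_linear_image_ball[where 'n = 3 and 'm = 3]
    by (intro exI[of _ "sqrt 3"]) auto
  moreover have "lesssim_on {T..} (\<lambda>t. norm (A t)) (\<lambda>t. 1 + \<bar>t\<bar>)"
    unfolding lesssim_on_def
  proof (intro exI conjI ballI)
    let ?c = "?a + ?v * (1 + \<bar>T\<bar>)"
    show "0 < ?c"
      using v by (intro add_nonneg_pos[OF norm_ge_zero] mult_pos_pos) linarith+
    fix t :: real
    have "\<bar>t - T\<bar> \<le> (1 + \<bar>T\<bar>) * (1 + \<bar>t\<bar>)"
      using mult_nonneg_nonneg[of "\<bar>T\<bar>" "\<bar>t\<bar>"] abs_triangle_ineq4[of t T]
      unfolding ring_distribs by linarith
    then have "?v * \<bar>t - T\<bar> \<le> ?v * ((1 + \<bar>T\<bar>) * (1 + \<bar>t\<bar>))"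
      using v by (intro mult_left_mono) auto
    moreover have "?a \<le> ?a * (1 + \<bar>t\<bar>)"
      by (simp add: mult_le_cancel_left1)
    ultimately show "norm (A t) \<le> ?c * (1 + \<bar>t\<bar>)"
      using norm_le_linear[OF assms(1), of t T]
      unfolding ring_distribs by linarith
  qed
  moreover have "lesssim_on {T..} (\<lambda>t. 1 + \<bar>t\<bar>) (\<lambda>t. norm (A t))"
    unfolding lesssim_on_def
  proof (intro exI conjI ballI)
    \<comment> \<open>The linear bound gives \<open>1 + |t| \<le> |A(t)| / v + ?b\<close>; the constant \<open>?b\<close> is absorbed by
      means of \<open>1 \<le> 2 |A(t)|\<close>.\<close>
    let ?b = "1 + \<bar>T\<bar> + ?a / ?v"
    let ?c = "1 / ?v + 2 * ?b"
    have b: "?b > 0"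
      using v by (intro add_pos_nonneg) auto
    then show "0 < ?c"
      using v by (intro add_pos_pos) auto
    fix t :: real assume "t \<in> {T..}"
    then have t: "t \<ge> T" by simp
    have "(t - T) \<le> (norm (A t) + ?a) / ?v"
      using norm_ge_linear[OF assms t] v by (simp add: pos_le_divide_eq mult.commute)
    then have "1 + \<bar>t\<bar> \<le> norm (A t) / ?v + ?b"
      using t by (simp add: add_divide_distrib)
    also have "?b \<le> ?b * (2 * norm (A t))"
      using norm_ge_half_if_det_1[OF det_eq_1[OF assms(1)], of t] b
      by (simp only: mult_le_cancel_left1) simp
    finally show "1 + \<bar>t\<bar> \<le> ?c * norm (A t)"
      by (simp add: algebra_simps)
  qed
  ultimately show ?thesis
    by (simp add: sim_on_def sqrt_trace_mult_transpose_eq_norm)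
qed

end
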